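(* Let $l \geq 1$ be an integer and let $G$ be a finite connected graph. Let $H_1$ be the graph obtained from a path $x_1 - x_2 - \cdots - x_{l+1}$ on $l+1$ vertices by adding two new vertices $a, b$, each adjacent only to $x_1$ (so $a$ and $b$ are non-adjacent). Let $H_2$ be the graph obtained from $H_1$ by adding the edge $ab$. If $G$ contains neither $H_1$ nor $H_2$ as an induced subgraph, then $c(G) \leq l+1$.
   Context: Cops and Robber game on a finite connected graph $G$: a player controlling $k$ cops places them on vertices (not necessarily distinct), then the robber is placed on a vertex; then the cops and the robber alternately move, each piece in its turn either moving to an adjacent vertex or staying put. The cops win if after finitely many rounds some cop occupies the same vertex as the robber; both sides have complete information. The cop number $c(G)$ is the minimum number of cops that can guarantee capture of the robber on $G$. *)

theory Defs
  imports "Graph_Theory.Graph_Theory"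
begin

definition move :: "('a, 'b) pre_digraph \<Rightarrow> 'a \<Rightarrow> 'a \<Rightarrow> bool" where
  "move G u v \<longleftrightarrow> u \<in> verts G \<and> (v = u \<or> u \<rightarrow>\<^bsub>G\<^esub> v)"

text \<open>
  A robber play is the sequence of the robber's positions: \<open>r 0\<close> is the initial placement and
  \<open>r (Suc t)\<close> the position after his move in round \<open>Suc t\<close>.  It does not stop at capture; what
  happens afterwards has no influence on who wins.
\<close>

definition robber_play :: "('a, 'b) pre_digraph \<Rightarrow> (nat \<Rightarrow> 'a) \<Rightarrow> bool" where
  "robber_play G r \<longleftrightarrow> r 0 \<in> verts G \<and> (\<forall>t. move G (r t) (r (Suc t)))"

text \<open>
  A strategy assigns to every cop and every list of robber positions seen so far (oldest first) the
  position of that cop.  The cops' own past positions are determined by the strategy and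
  these data, so the robber's history is the complete information available to the cops.  Against
  the play \<open>r\<close>, cop \<open>i\<close> starts at \<open>cop_pos \<sigma> r i 0\<close>, without knowing \<open>r\<close>, and moves in
  round \<open>Suc t\<close> to \<open>cop_pos \<sigma> r i (Suc t)\<close>, knowing \<open>r 0, \<dots>, r t\<close>; then the robber
  moves from \<open>r t\<close> to \<open>r (Suc t)\<close>.
\<close>

type_synonym 'a cop_strategy = "nat \<Rightarrow> 'a list \<Rightarrow> 'a"

definition cop_pos :: "'a cop_strategy \<Rightarrow> (nat \<Rightarrow> 'a) \<Rightarrow> nat \<Rightarrow> nat \<Rightarrow> 'a" where
  "cop_pos \<sigma> r i t = \<sigma> i (map r [0..<t])"

definition legal_strategy :: "('a, 'b) pre_digraph \<Rightarrow> nat \<Rightarrow> 'a cop_strategy \<Rightarrow> bool" where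
  "legal_strategy G k \<sigma> \<longleftrightarrow>
     (\<forall>i<k. \<sigma> i [] \<in> verts G) \<and>
     (\<forall>r. robber_play G r \<longrightarrow> (\<forall>i<k. \<forall>t. move G (cop_pos \<sigma> r i t) (cop_pos \<sigma> r i (Suc t))))"

text \<open>
  Capture can happen after a move (or placement) of the robber, or after a move of the cops.
\<close>

definition captures :: "nat \<Rightarrow> 'a cop_strategy \<Rightarrow> (nat \<Rightarrow> 'a) \<Rightarrow> bool" where
  "captures k \<sigma> r \<longleftrightarrow> (\<exists>t. \<exists>i<k. cop_pos \<sigma> r i t = r t \<or> cop_pos \<sigma> r i (Suc t) = r t)"

definition cops_win :: "('a, 'b) pre_digraph \<Rightarrow> nat \<Rightarrow> bool" where
  "cops_win G k \<longleftrightarrow> (\<exists>\<sigma>. legal_strategy G k \<sigma> \<and> (\<forall>r. robber_play G r \<longrightarrow> captures k \<sigma> r))"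

definition cop_number :: "('a, 'b) pre_digraph \<Rightarrow> nat" where
  "cop_number G = (LEAST k. cops_win G k)"

text \<open>
  The minimum is attained on every finite graph: a cop on each vertex wins at once.
\<close>

lemma cops_win_card_verts:
  assumes "finite (verts G)"
  shows "cops_win G (card (verts G))"
proof -
  obtain h where h: "bij_betw h {0..<card (verts G)} (verts G)"
    using assms ex_bij_betw_nat_finite by blast
  have in_G: "h i \<in> verts G" if "i < card (verts G)" for i
    using h that by (auto simp: bij_betw_def)
  have occupied: "\<exists>i<card (verts G). h i = v" if "v \<in> verts G" for v
    using h that unfolding bij_betw_def by (metis atLeastLessThan_iff imageE)
  have "legal_strategy G (card (verts G)) (\<lambda>i _. h i)"
    using in_G by (simp add: legal_strategy_def cop_pos_def move_def)
  moreover have "captures (card (verts G)) (\<lambda>i _. h i) r" if "robber_play G r" for r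
    using occupied[of "r 0"] that by (fastforce simp: captures_def cop_pos_def robber_play_def)
  ultimately show ?thesis
    unfolding cops_win_def by blast
qed

lemma cops_win_cop_number:
  assumes "finite (verts G)"
  shows "cops_win G (cop_number G)"
  unfolding cop_number_def using cops_win_card_verts[OF assms] by (rule LeastI)

definition contains_induced :: "('a, 'b) pre_digraph \<Rightarrow> ('c, 'd) pre_digraph \<Rightarrow> bool" where
  "contains_induced G H \<longleftrightarrow> (\<exists>K. induced_subgraph K G \<and> digraph_iso H K)"

text \<open>
  \<open>PathV i\<close> is \<open>x\<^sub>i\<close>, and \<open>PendA\<close>, \<open>PendB\<close> are \<open>a\<close>, \<open>b\<close>.
\<close>

datatype hvertex = PathV nat | PendA | PendB

definition H1 :: "nat \<Rightarrow> hvertex pair_pre_digraph" where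
  "H1 l = (let E = {(PathV i, PathV (Suc i)) | i. i \<in> {1..l}}
                   \<union> {(PendA, PathV 1), (PendB, PathV 1)}
           in \<lparr> pverts = PathV ` {1..l+1} \<union> {PendA, PendB}, parcs = E \<union> E\<inverse> \<rparr>)"

definition H2 :: "nat \<Rightarrow> hvertex pair_pre_digraph" where
  "H2 l = \<lparr> pverts = pverts (H1 l), parcs = parcs (H1 l) \<union> {(PendA, PendB), (PendB, PendA)} \<rparr>"

lemma pair_graph_H1: "pair_graph (H1 l)"
proof -
  have "finite (parcs (H1 l))"
    by (rule finite_subset[of _ "pverts (H1 l) \<times> pverts (H1 l)"]) (auto simp: H1_def Let_def)
  then show ?thesis
    by unfold_locales (auto simp: H1_def Let_def symmetric_def sym_def)
qed

lemma pair_graph_H2: "pair_graph (H2 l)"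
proof -
  interpret pair_graph "H1 l" by (rule pair_graph_H1)
  have "finite (parcs (H2 l))"
    using pair_finite_arcs by (simp add: H2_def)
  moreover have "PendA \<in> pverts (H1 l)" "PendB \<in> pverts (H1 l)"
    by (auto simp: H1_def Let_def)
  moreover have "sym (parcs (H1 l))"
    using pair_sym_arcs by (simp add: symmetric_def)
  ultimately show ?thesis
    using pair_finite_verts pair_no_loops wellformed'
    by unfold_locales (auto simp: H2_def symmetric_def sym_def)
qed

end

theory Submission
  imports Defs
begin

text \<open>
  Suppose the robber can evade \<open>l + 1\<close> cops, and let the cops follow his trail in a train, cop \<open>i\<close>
  being \<open>i\<close> steps behind the head.  Among all positions that the robber survives and in which the
  cops are this close together, take one with minimal distance \<open>d\<close> from the head to the robber.
  By minimality, and as every cop of the train can become its head, stretches of the trail of length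
  up to \<open>d + l\<close> have no shortcut below distance \<open>d\<close>.  A neighbour \<open>u\<close> of the trail
  off the trail would yield an induced \<open>H\<^sub>1\<close> or \<open>H\<^sub>2\<close>: its last
  neighbour on the trail plays \<open>x\<^sub>1\<close>, with \<open>u\<close> and the preceding trail vertex as
  \<open>a\<close>, \<open>b\<close>.  For \<open>d = 2\<close>, the last cop first has to leave the train and guard \<open>u\<close>.
  Otherwise the trail sweeps the whole graph, whose degrees are then at most 2.
\<close>


section \<open>Positions of the game\<close>

lemma (in wf_digraph) move_in_verts:
  assumes "move G u v"
  shows "u \<in> verts G" "v \<in> verts G"
  using assms by (auto simp: move_def adj_in_verts)

lemma move_refl: "v \<in> verts G \<Longrightarrow> move G v v"
  by (simp add: move_def)

lemma (in graph) arc_sym: "u \<rightarrow>\<^bsub>G\<^esub> v \<Longrightarrow> v \<rightarrow>\<^bsub>G\<^esub> u"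
  by (rule arcs_ends_symmetric[OF sym_arcs])

lemma (in graph) move_sym: "move G u v \<Longrightarrow> move G v u"
  by (metis arc_sym move_def adj_in_verts(2))

text \<open>The cops are to move. As a least fixed point this needs no bound on the number of
  rounds, and where it fails the robber has a surviving answer to every move of the cops. A robber
  who steps onto a cop is caught in the next round, by that cop staying put.\<close>

inductive cop_win_from :: "('a, 'b) pre_digraph \<Rightarrow> nat \<Rightarrow> (nat \<Rightarrow> 'a) \<Rightarrow> 'a \<Rightarrow> bool"
  for G k where
  capture: "\<lbrakk>\<forall>i<k. move G (p i) (p' i); j < k; p' j = r\<rbrakk> \<Longrightarrow> cop_win_from G k p r"
| round: "\<lbrakk>\<forall>i<k. move G (p i) (p' i); \<And>r'. move G r r' \<Longrightarrow> cop_win_from G k p' r'\<rbrakk>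
    \<Longrightarrow> cop_win_from G k p r"

text \<open>Only plays starting at \<open>r\<close> matter, so strategies for different robber
  positions can be glued by case distinction on the history.\<close>

definition catches_from ::
  "('a, 'b) pre_digraph \<Rightarrow> nat \<Rightarrow> (nat \<Rightarrow> 'a) \<Rightarrow> 'a \<Rightarrow> 'a cop_strategy \<Rightarrow> bool" where
  "catches_from G k p r \<sigma> \<longleftrightarrow> (\<forall>i. \<sigma> i [] = p i) \<and> (\<forall>\<rho>. robber_play G \<rho> \<longrightarrow> \<rho> 0 = r \<longrightarrow>
    (\<forall>i<k. \<forall>t. move G (cop_pos \<sigma> \<rho> i t) (cop_pos \<sigma> \<rho> i (Suc t))) \<and> captures k \<sigma> \<rho>)"

lemma (in wf_digraph) cop_win_from_strategy:
  assumes "cop_win_from G k p r"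
  shows "\<exists>\<sigma>. catches_from G k p r \<sigma>"
  using assms
proof induction
  case (capture p p' j r)
  let ?\<sigma> = "\<lambda>i h. if h = [] then p i else p' i"
  have pos: "cop_pos ?\<sigma> \<rho> i t = (if t = 0 then p i else p' i)" for \<rho> i t
    by (simp add: cop_pos_def)
  have "captures k ?\<sigma> \<rho>" if "\<rho> 0 = r" for \<rho>
    unfolding captures_def pos using capture that by (intro exI[of _ 0] exI[of _ j]) simp
  moreover have "move G (cop_pos ?\<sigma> \<rho> i t) (cop_pos ?\<sigma> \<rho> i (Suc t))" if "i < k" for \<rho> i t
  proof -
    have "move G (p i) (p' i)" using capture that by blast
    then show ?thesis
      unfolding pos using move_refl[OF move_in_verts(2)] by simp
  qed
  ultimately have "catches_from G k p r ?\<sigma>"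
    unfolding catches_from_def by simp
  then show ?case by (rule exI[of _ ?\<sigma>])
next
  case (round p p' r)
  have "\<forall>y. \<exists>\<tau>. move G r y \<longrightarrow> catches_from G k p' y \<tau>"
    using round.IH by blast
  from choice[OF this] obtain \<tau>
    where \<tau>: "catches_from G k p' y (\<tau> y)" if "move G r y" for y
    by blast
  \<comment> \<open>From the robber's reply \<open>y\<close> on, the oldest entry is dropped:
    \<open>\<tau> y\<close> sees a play that starts at \<open>y\<close> with the cops at
    \<open>p'\<close>.\<close>
  let ?\<sigma> = "\<lambda>i h. case h of [] \<Rightarrow> p i | x # h' \<Rightarrow> (case h' of [] \<Rightarrow> p' i | y # zs \<Rightarrow> \<tau> y i h')"
  have "(\<forall>i<k. \<forall>t. move G (cop_pos ?\<sigma> \<rho> i t) (cop_pos ?\<sigma> \<rho> i (Suc t))) \<and> captures k ?\<sigma> \<rho>"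
    if \<rho>: "robber_play G \<rho>" "\<rho> 0 = r" for \<rho>
  proof -
    let ?\<rho>' = "\<lambda>t. \<rho> (Suc t)"
    have first: "move G r (\<rho> 1)"
      using \<rho> by (auto simp: robber_play_def)
    have play: "robber_play G ?\<rho>'"
      using \<rho> move_in_verts(2)[OF first] by (simp add: robber_play_def)
    note c = \<tau>[OF first, unfolded catches_from_def]
    have rest: "\<forall>i<k. \<forall>t. move G (cop_pos (\<tau> (\<rho> 1)) ?\<rho>' i t) (cop_pos (\<tau> (\<rho> 1)) ?\<rho>' i (Suc t))"
      "captures k (\<tau> (\<rho> 1)) ?\<rho>'"
      using c[THEN conjunct2, rule_format, OF play] by simp_all
    have pos: "cop_pos ?\<sigma> \<rho> i (Suc t) = cop_pos (\<tau> (\<rho> 1)) ?\<rho>' i t" for i t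
    proof (cases t)
      case 0
      then show ?thesis using c[THEN conjunct1] by (simp add: cop_pos_def)
    next
      case (Suc t')
      then show ?thesis by (simp add: cop_pos_def map_upt_Suc del: upt_Suc)
    qed
    have pos0: "cop_pos ?\<sigma> \<rho> i 0 = p i" "cop_pos ?\<sigma> \<rho> i (Suc 0) = p' i" for i
      by (simp_all add: cop_pos_def)
    have "move G (cop_pos ?\<sigma> \<rho> i t) (cop_pos ?\<sigma> \<rho> i (Suc t))" if "i < k" for i t
    proof (cases t)
      case 0
      then show ?thesis using round.hyps(1) that by (simp only: pos0)
    next
      case (Suc t')
      then show ?thesis using rest(1) that by (simp only: pos)
    qed
    moreover have "captures k ?\<sigma> \<rho>"
      using rest(2) unfolding captures_def pos[symmetric] by blast
    ultimately show ?thesis by blast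
  qed
  then have "catches_from G k p r ?\<sigma>"
    unfolding catches_from_def by simp
  then show ?case by (rule exI[of _ ?\<sigma>])
qed

lemma (in wf_digraph) cops_winI:
  assumes p: "\<And>i. i < k \<Longrightarrow> p i \<in> verts G"
    and win: "\<And>r. r \<in> verts G \<Longrightarrow> cop_win_from G k p r"
  shows "cops_win G k"
proof -
  have "\<forall>y. \<exists>\<tau>. y \<in> verts G \<longrightarrow> catches_from G k p y \<tau>"
    using cop_win_from_strategy[OF win] by blast
  from choice[OF this] obtain \<tau>
    where \<tau>: "catches_from G k p y (\<tau> y)" if "y \<in> verts G" for y
    by blast
  let ?\<sigma> = "\<lambda>i h. case h of [] \<Rightarrow> p i | x # zs \<Rightarrow> \<tau> x i h"
  have "(\<forall>i<k. \<forall>t. move G (cop_pos ?\<sigma> \<rho> i t) (cop_pos ?\<sigma> \<rho> i (Suc t))) \<and> captures k ?\<sigma> \<rho>"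
    if \<rho>: "robber_play G \<rho>" for \<rho>
  proof -
    have \<rho>0: "\<rho> 0 \<in> verts G"
      using \<rho> by (simp add: robber_play_def)
    note c = \<tau>[OF \<rho>0, unfolded catches_from_def]
    have pos: "cop_pos ?\<sigma> \<rho> i t = cop_pos (\<tau> (\<rho> 0)) \<rho> i t" for i t
      using c[THEN conjunct1] by (cases t) (simp_all add: cop_pos_def map_upt_Suc del: upt_Suc)
    show ?thesis
      unfolding pos captures_def
      using c[THEN conjunct2, rule_format, OF \<rho> refl] by (simp add: captures_def)
  qed
  then have "legal_strategy G k ?\<sigma> \<and> (\<forall>\<rho>. robber_play G \<rho> \<longrightarrow> captures k ?\<sigma> \<rho>)"
    unfolding legal_strategy_def using p by simp
  then show ?thesis
    unfolding cops_win_def by blast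
qed

text \<open>Cops are interchangeable. For an involution \<open>\<pi>\<close>, the capturing cop
  \<open>j\<close> simply becomes \<open>\<pi> j\<close>.\<close>

lemma cop_win_from_permute:
  assumes "cop_win_from G k p r" and \<pi>: "\<And>i. i < k \<Longrightarrow> \<pi> i < k" "\<And>i. \<pi> (\<pi> i) = i"
  shows "cop_win_from G k (\<lambda>i. p (\<pi> i)) r"
  using assms(1)
proof induction
  case (capture p p' j r)
  show ?case
  proof (rule cop_win_from.capture[where p' = "\<lambda>i. p' (\<pi> i)" and j = "\<pi> j"])
  qed (use capture \<pi> in auto)
next
  case (round p p' r)
  show ?case
  proof (rule cop_win_from.round[where p' = "\<lambda>i. p' (\<pi> i)"])
  qed (use round \<pi> in auto)
qed

section \<open>Positions that the robber survives\<close>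

definition escapes :: "('a, 'b) pre_digraph \<Rightarrow> nat \<Rightarrow> (nat \<Rightarrow> 'a) \<Rightarrow> 'a \<Rightarrow> bool" where
  "escapes G k p r \<longleftrightarrow> (\<forall>i<k. p i \<in> verts G) \<and> r \<in> verts G \<and> \<not> cop_win_from G k p r"

lemma escapes_permute:
  assumes "escapes G k p r" and \<pi>: "\<And>i. i < k \<Longrightarrow> \<pi> i < k" "\<And>i. \<pi> (\<pi> i) = i"
  shows "escapes G k (\<lambda>i. p (\<pi> i)) r"
  using assms cop_win_from_permute[of G k "\<lambda>i. p (\<pi> i)" r \<pi>] by (auto simp: escapes_def)

lemma escapes_not_move:
  assumes "escapes G k p r" "i < k"
  shows "\<not> move G (p i) r"
proof
  assume r: "move G (p i) r"
  have "cop_win_from G k p r"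
  proof (rule cop_win_from.capture[where p' = "p(i := r)" and j = i])
  qed (use r assms in \<open>auto simp: escapes_def move_refl\<close>)
  then show False using assms by (simp add: escapes_def)
qed

lemma (in wf_digraph) escapes_round:
  assumes "escapes G k p r" "\<And>i. i < k \<Longrightarrow> move G (p i) (p' i)"
  obtains r' where "move G r r'" "escapes G k p' r'"
proof -
  obtain r' where "move G r r'" "\<not> cop_win_from G k p' r'"
    using assms cop_win_from.round[of k G p p' r] unfolding escapes_def by blast
  then show ?thesis
    using that assms(2) move_in_verts unfolding escapes_def by blast
qed

text \<open>A cop plan is given as a function \<open>C\<close> of the whole play, and
  \<open>causal\<close> says that at time \<open>t\<close> it reads only earlier robber positions.
  The robber's surviving answers can then be chosen round by round, giving one infinite play against
  the plan.\<close>

lemma (in wf_digraph) escaping_play: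
  fixes C :: "(nat \<Rightarrow> 'a) \<Rightarrow> nat \<Rightarrow> nat \<Rightarrow> 'a"
  assumes causal: "\<And>\<rho> \<rho>' t. (\<And>s. s < t \<Longrightarrow> \<rho> s = \<rho>' s) \<Longrightarrow> C \<rho> t = C \<rho>' t"
    and legal: "\<And>\<rho> t i. \<lbrakk>\<rho> 0 = r; \<And>s. s < t \<Longrightarrow> move G (\<rho> s) (\<rho> (Suc s)); i < k\<rbrakk>
      \<Longrightarrow> move G (C \<rho> t i) (C \<rho> (Suc t) i)"
    and start: "\<And>\<rho>. C \<rho> 0 = p" "escapes G k p r"
  obtains \<rho> where "\<rho> 0 = r" "\<And>t. move G (\<rho> t) (\<rho> (Suc t))" "\<And>t. escapes G k (C \<rho> t) (\<rho> t)"
proof -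
  let ?P = "\<lambda>t \<rho>. \<rho> 0 = r \<and> (\<forall>s<t. move G (\<rho> s) (\<rho> (Suc s))) \<and> escapes G k (C \<rho> t) (\<rho> t)"
  have "\<exists>f. \<forall>t. ?P t (f t) \<and> (\<forall>s\<le>t. f (Suc t) s = f t s)"
  proof (rule dependent_nat_choice)
    show "\<exists>\<rho>. ?P 0 \<rho>"
      using start by (intro exI[of _ "\<lambda>_. r"]) auto
  next
    fix \<rho> t
    assume \<rho>: "?P t \<rho>"
    then have "move G (C \<rho> t i) (C \<rho> (Suc t) i)" if "i < k" for i
      using legal that by blast
    moreover have "escapes G k (C \<rho> t) (\<rho> t)"
      using \<rho> by blast
    ultimately obtain r' where r': "move G (\<rho> t) r'" "escapes G k (C \<rho> (Suc t)) r'"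
      using escapes_round[of k "C \<rho> t" "\<rho> t" "C \<rho> (Suc t)"] by blast
    \<comment> \<open>By causality, the cops' position at time \<open>Suc t\<close> is unaffected by
      this update.\<close>
    let ?\<rho>' = "\<rho>(Suc t := r')"
    have "C ?\<rho>' (Suc t) = C \<rho> (Suc t)"
      by (rule causal) simp
    moreover have "move G (?\<rho>' s) (?\<rho>' (Suc s))" if "s < Suc t" for s
      using \<rho> r'(1) that by (cases "s = t") auto
    ultimately have "?P (Suc t) ?\<rho>' \<and> (\<forall>s\<le>t. ?\<rho>' s = \<rho> s)"
      using \<rho> r'(2) by simp
    then show "\<exists>\<rho>'. ?P (Suc t) \<rho>' \<and> (\<forall>s\<le>t. \<rho>' s = \<rho> s)"
      by (rule exI[of _ ?\<rho>'])
  qed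
  then obtain f where f01: "\<forall>t. ?P t (f t) \<and> (\<forall>s\<le>t. f (Suc t) s = f t s)" ..
  have f: "?P t (f t)" "s \<le> t \<Longrightarrow> f (Suc t) s = f t s" for s t
    using f01 by simp_all
  have agree: "f (s + n) s = f s s" for s n
  proof (induction n)
    case (Suc n)
    then show ?case using f(2)[of s "s + n"] by simp
  qed simp
  have agree': "f t s = f s s" if "s \<le> t" for s t
    using agree[of s "t - s"] that by simp
  show ?thesis
  \<comment> \<open>The diagonal agrees with \<open>f t\<close> up to time \<open>t\<close>, which
    is all that \<open>C\<close> reads by then.\<close>
  proof (rule that[of "\<lambda>t. f t t"])
    show "f 0 0 = r"
      using f(1) by blast
    show "move G (f t t) (f (Suc t) (Suc t))" for t
      using f(1)[of "Suc t"] f(2)[of t t] by auto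
    have "C (\<lambda>t. f t t) t = C (f t) t" for t
      by (rule causal, rule agree'[symmetric], rule less_imp_le)
    then show "escapes G k (C (\<lambda>t. f t t) t) (f t t)" for t
      using f(1) by simp
  qed
qed

section \<open>Walks\<close>

lemma relpowp_trans: "(R ^^ m) x y \<Longrightarrow> (R ^^ n) y z \<Longrightarrow> (R ^^ (m + n)) x z"
  unfolding relpowp_add by blast

lemma relpowp_walk:
  assumes "\<And>n. R (w n) (w (Suc n))"
  shows "(R ^^ m) (w n) (w (n + m))"
  by (induction m) (auto intro: assms)

lemma (in graph) reach_sym: "(move G ^^ n) x y \<Longrightarrow> (move G ^^ n) y x"
proof (induction n arbitrary: y)
  case (Suc n)
  then show ?case by (metis move_sym relpowp_Suc_E relpowp_Suc_I2)
qed auto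

text \<open>Since staying put is a move, \<open>(move G ^^ n) x y\<close> between vertices means
  distance at most \<open>n\<close>; distances are expressed in this way throughout.\<close>

lemma reach_mono:
  assumes "(move G ^^ m) x y" "y \<in> verts G" "m \<le> n"
  shows "(move G ^^ n) x y"
proof -
  have "(move G ^^ j) y y" for j
  proof (induction j)
    case (Suc j)
    show ?case using relpowp_Suc_I[of j "move G", OF Suc move_refl[OF assms(2)]] .
  qed simp
  from relpowp_trans[OF assms(1) this[of "n - m"]] show ?thesis
    using assms(3) by simp
qed

lemma (in graph) connected_reach:
  assumes "connected G" "x \<in> verts G" "y \<in> verts G"
  shows "\<exists>n. (move G ^^ n) x y"
proof -
  have "x \<rightarrow>\<^sup>* y"
    using symmetric_connected_imp_strongly_connected[OF sym_arcs assms(1)] assms by auto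
  then show ?thesis
  proof (induction rule: reachable_induct)
    case base
    show ?case by (rule exI[of _ 0]) simp
  next
    case (step y z)
    then obtain n where "(move G ^^ n) x y" by blast
    moreover have "move G y z" using step by (simp add: move_def adj_in_verts)
    ultimately show ?case by (metis relpowp_Suc_I)
  qed
qed

text \<open>Some vertex is visited infinitely often, by finiteness. This property passes to
  neighbours, because each late visit has all neighbours of the vertex just before or after it on
  the walk; connectedness spreads it to \<open>v\<close>.\<close>

lemma (in graph) walk_covers:
  assumes conn: "connected G"
    and w: "\<And>n. w n \<in> verts G"
    and nbrs: "\<And>n u. N \<le> n \<Longrightarrow> w (Suc n) \<rightarrow>\<^bsub>G\<^esub> u \<Longrightarrow> u = w n \<or> u = w (Suc (Suc n))"
    and v: "v \<in> verts G"
  shows "\<exists>n\<ge>M. w n = v"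
proof -
  let ?inf = "\<lambda>x. infinite {n. w n = x}"
  have "finite (range w)"
    using w by (intro finite_subset[OF _ finite_verts]) auto
  then obtain n0 where n0: "?inf (w n0)"
    using pigeonhole_infinite[of UNIV w] by auto
  have "w n0 \<rightarrow>\<^sup>* v"
    using symmetric_connected_imp_strongly_connected[OF sym_arcs conn] w v by auto
  then have "?inf v"
  proof (induction rule: reachable_induct)
    case base
    show ?case by (rule n0)
  next
    case (step x y)
    show ?case
      unfolding infinite_nat_iff_unbounded
    proof
      fix m
      obtain n where n: "n > Suc (max m N)" "w n = x"
        using step.IH unfolding infinite_nat_iff_unbounded by blast
      then obtain n' where [simp]: "n = Suc n'" by (cases n) auto
      have "y = w n' \<or> y = w (Suc n)"
        using nbrs[of n' y] n step.hyps by auto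
      then show "\<exists>n>m. n \<in> {n. w n = y}"
        using n by (elim disjE) (auto intro: exI[of _ n'] exI[of _ "Suc n"])
    qed
  qed
  then obtain n where "M < n" "w n = v"
    unfolding infinite_nat_iff_unbounded by blast
  then show ?thesis
    by (intro exI[of _ n]) simp
qed

section \<open>Induced copies of the two forbidden graphs\<close>

text \<open>An isomorphism also has to map arcs. Without multiple arcs, the vertex map determines
  the arc map \<open>g\<close>; with \<open>head G\<close> and \<open>tail G\<close> as incidence
  maps, the image of \<open>H\<close> is literally an induced subgraph of \<open>G\<close>.\<close>

lemma (in graph) contains_inducedI:
  assumes inj: "inj_on f (pverts H)" and f: "f ` pverts H \<subseteq> verts G"
    and H: "parcs H \<subseteq> pverts H \<times> pverts H"
    and arc: "\<And>x y. x \<in> pverts H \<Longrightarrow> y \<in> pverts H \<Longrightarrow> f x \<rightarrow>\<^bsub>G\<^esub> f y \<longleftrightarrow> (x, y) \<in> parcs H"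
  shows "contains_induced G (with_proj H)"
proof -
  let ?K = "G \<restriction> (f ` pverts H)"
  define g where "g = (\<lambda>(x, y). the_inv_into (arcs G) (arc_to_ends G) (f x, f y))"
  let ?h = "\<lparr> iso_verts = f, iso_arcs = g, iso_head = head G, iso_tail = tail G \<rparr>"
  have g: "g (x, y) \<in> arcs G" "tail G (g (x, y)) = f x" "head G (g (x, y)) = f y"
    if "(x, y) \<in> parcs H" for x y
  proof -
    have "f x \<rightarrow>\<^bsub>G\<^esub> f y"
      using arc that H by blast
    then have "(f x, f y) \<in> arc_to_ends G ` arcs G"
      by (simp add: arcs_ends_def)
    note fxy = f_the_inv_into_f[OF inj_on_arc_to_ends this]
      the_inv_into_into[OF inj_on_arc_to_ends this subset_refl]
    then have "arc_to_ends G (g (x, y)) = (f x, f y)" "g (x, y) \<in> arcs G"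
      unfolding g_def by simp_all
    then show "g (x, y) \<in> arcs G" "tail G (g (x, y)) = f x" "head G (g (x, y)) = f y"
      by (auto simp: arc_to_ends_def)
  qed
  interpret H: wf_digraph "with_proj H"
    using H by unfold_locales auto
  have "inj_on g (parcs H)"
  proof (rule inj_onI)
    fix a b
    assume ab: "a \<in> parcs H" "b \<in> parcs H" "g a = g b"
    obtain a1 a2 b1 b2 where [simp]: "a = (a1, a2)" "b = (b1, b2)"
      by (cases a, cases b)
    have "f a1 = f b1" "f a2 = f b2"
      using g(2,3)[of a1 a2] g(2,3)[of b1 b2] ab by simp_all
    moreover have "a1 \<in> pverts H" "b1 \<in> pverts H" "a2 \<in> pverts H" "b2 \<in> pverts H"
      using ab(1,2) H by auto
    ultimately show "a = b"
      using inj_onD[OF inj] by simp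
  qed
  then have "pre_digraph.digraph_isomorphism (with_proj H) ?h"
    unfolding pre_digraph.digraph_isomorphism_def
    using inj g(2,3)[symmetric] H.wf_digraph by (simp add: Ball_def split_paired_All)
  moreover have "arcs ?K = g ` parcs H"
  proof
    show "g ` parcs H \<subseteq> arcs ?K"
      using g H by (auto simp: induce_subgraph_def)
  next
    show "arcs ?K \<subseteq> g ` parcs H"
    proof
      fix e
      assume "e \<in> arcs ?K"
      then obtain x y where e: "e \<in> arcs G" "tail G e = f x" "head G e = f y"
        "x \<in> pverts H" "y \<in> pverts H"
        by (auto simp: induce_subgraph_def)
      then have "f x \<rightarrow>\<^bsub>G\<^esub> f y"
        by (intro dominatesI[of e]) (auto simp: arc_to_ends_def)
      then have xy: "(x, y) \<in> parcs H"
        using arc e by blast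
      then have "arc_to_ends G e = arc_to_ends G (g (x, y))"
        using g e by (simp add: arc_to_ends_def)
      then have "e = g (x, y)"
        using no_multi_arcs e g(1)[OF xy] by blast
      then show "e \<in> g ` parcs H" using xy by blast
    qed
  qed
  then have "?K = app_iso ?h (with_proj H)"
    by (simp add: app_iso_def induce_subgraph_def)
  ultimately have "digraph_iso (with_proj H) ?K"
    unfolding digraph_iso_def by blast
  moreover have "induced_subgraph ?K G"
    using f by (rule induced_induce)
  ultimately show ?thesis
    unfolding contains_induced_def by blast
qed

text \<open>\<open>v 0\<close> and \<open>u\<close> play \<open>PendA\<close> and
  \<open>PendB\<close>. Only the adjacency of these two is left open, and it decides between
  \<open>H1\<close> and \<open>H2\<close>.\<close>

lemma (in graph) contains_claw_or_paw:
  assumes path: "\<And>i. i \<le> l \<Longrightarrow> v i \<rightarrow>\<^bsub>G\<^esub> v (Suc i)"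
    and far: "\<And>i j. i + 2 \<le> j \<Longrightarrow> j \<le> Suc l \<Longrightarrow> v i \<noteq> v j \<and> \<not> v i \<rightarrow>\<^bsub>G\<^esub> v j"
    and u: "u \<rightarrow>\<^bsub>G\<^esub> v 1" "u \<noteq> v 0"
    and u_far: "\<And>j. 2 \<le> j \<Longrightarrow> j \<le> Suc l \<Longrightarrow> u \<noteq> v j \<and> \<not> u \<rightarrow>\<^bsub>G\<^esub> v j"
  shows "contains_induced G (with_proj (H1 l)) \<or> contains_induced G (with_proj (H2 l))"
proof -
  define f where "f = case_hvertex v (v 0) u"
  have f [simp]: "f (PathV i) = v i" "f PendA = v 0" "f PendB = u" for i
    by (auto simp: f_def)
  have arcs_v: "v i \<rightarrow>\<^bsub>G\<^esub> v j \<longleftrightarrow> j = Suc i \<or> i = Suc j" if "i \<le> Suc l" "j \<le> Suc l" for i j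
  proof -
    consider "j = i" | "j = Suc i" | "i = Suc j" | "i + 2 \<le> j" | "j + 2 \<le> i" by linarith
    then show ?thesis
      using that path[of i] path[of j] far[of i j] far[of j i] arc_sym[of "v i" "v j"]
        arc_sym[of "v j" "v i"] adj_not_same[of "v i"] by cases auto
  qed
  have eq_v: "v i = v j \<longleftrightarrow> i = j" if "i \<le> Suc l" "j \<le> Suc l" for i j
  proof -
    consider "j = i" | "j = Suc i" | "i = Suc j" | "i + 2 \<le> j" | "j + 2 \<le> i" by linarith
    then show ?thesis
      using that path[of i] path[of j] far[of i j] far[of j i] adj_not_same[of "v i"] by cases auto
  qed
  have arcs_u: "u \<rightarrow>\<^bsub>G\<^esub> v j \<longleftrightarrow> j = 1" "v j \<rightarrow>\<^bsub>G\<^esub> u \<longleftrightarrow> j = 1" "u \<noteq> v j" "v j \<noteq> u"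
    if "1 \<le> j" "j \<le> Suc l" for j
    using u u_far[of j] that arc_sym[of u "v j"] arc_sym[of "v j" u] adj_not_same[of u]
    by (cases "j = 1"; auto)+
  have no_loop: "\<not> u \<rightarrow>\<^bsub>G\<^esub> u" using adj_not_same by blast
  have flip: "v 0 \<rightarrow>\<^bsub>G\<^esub> u \<longleftrightarrow> u \<rightarrow>\<^bsub>G\<^esub> v 0"
    using arc_sym[of u "v 0"] arc_sym[of "v 0" u] by blast
  let ?H = "if u \<rightarrow>\<^bsub>G\<^esub> v 0 then H2 l else H1 l"
  have "contains_induced G (with_proj ?H)"
  proof (rule contains_inducedI[where f = f])
    have "pverts ?H = PathV ` {1..l+1} \<union> {PendA, PendB}"
      by (auto simp: H1_def H2_def Let_def)
    note V = this
    show "inj_on f (pverts ?H)"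
      unfolding V by (auto simp: inj_on_def eq_v arcs_u u(2) u(2)[symmetric])
    have "v i \<in> verts G" if "i \<le> Suc l" for i
      using path[of i] path[of l] that adj_in_verts by (cases "i = Suc l") auto
    then show "f ` pverts ?H \<subseteq> verts G"
      unfolding V using adj_in_verts(1)[OF u(1)] by auto
    show "parcs ?H \<subseteq> pverts ?H \<times> pverts ?H"
      by (auto simp: H1_def H2_def Let_def)
    show "f x \<rightarrow>\<^bsub>G\<^esub> f y \<longleftrightarrow> (x, y) \<in> parcs ?H" if "x \<in> pverts ?H" "y \<in> pverts ?H" for x y
      using that unfolding V
      by (auto simp: H1_def H2_def Let_def arcs_v arcs_u no_loop flip)
  qed
  then show ?thesis by (auto split: if_splits)
qed

section \<open>The train of cops\<close>

text \<open>The cops up to \<open>L\<close> form the train, the others wait. If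
  \<open>m \<le> d\<close>, a shortcut would bring the head closer to the robber than
  \<open>d\<close>; if \<open>m > d\<close>, it would do so for the cop \<open>m - d\<close> places
  behind the head. Both contradict \<open>min\<close>. It is used with \<open>L = l\<close> for the
  full train and with \<open>L = 0\<close> for a single pursuer.\<close>

lemma (in graph) no_shortcut_walk:
  fixes d L k :: nat
  assumes start: "escapes G k p r" "L < k" "1 \<le> d" "(move G ^^ d) (p 0) r"
    and close: "\<And>i. i \<le> L \<Longrightarrow> (move G ^^ i) (p i) (p 0)"
    and min: "\<And>q s e. \<lbrakk>escapes G k q s; \<And>i. i \<le> L \<Longrightarrow> (move G ^^ i) (q i) (q 0);
      (move G ^^ e) (q 0) s\<rbrakk> \<Longrightarrow> d \<le> e"
  obtains w c where
    "\<And>n. move G (w n) (w (Suc n))"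
    "\<And>t. escapes G k (c t) (w (t + d))"
    "\<And>t i. i \<le> L \<Longrightarrow> i \<le> t \<Longrightarrow> c t i = w (t - i)"
    "\<And>t i. L < i \<Longrightarrow> c t i = p i"
    "\<And>n m e. m \<le> d + L \<Longrightarrow> (move G ^^ e) (w n) (w (n + m)) \<Longrightarrow> min m d \<le> e"
proof -
  have "\<forall>i. \<exists>y. i \<le> L \<longrightarrow> y 0 = p i \<and> y i = p 0 \<and> (\<forall>t<i. move G (y t) (y (Suc t)))"
    using close unfolding relpowp_fun_conv by blast
  from choice[OF this] obtain y
    where y: "y i 0 = p i" "y i i = p 0" "t < i \<Longrightarrow> move G (y i t) (y i (Suc t))"
    if "i \<le> L" for i t
    by blast
  obtain w0 where w0: "w0 0 = p 0" "w0 d = r" "\<And>t. t < d \<Longrightarrow> move G (w0 t) (w0 (Suc t))"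
    using start(4) unfolding relpowp_fun_conv by blast
  \<comment> \<open>The trail is a walk of length \<open>d\<close> from the head to the robber,
    continued by the robber's play. Cop \<open>i\<close> first walks along \<open>y i\<close> to the
    start of the trail, arriving at time \<open>i\<close>. As \<open>1 \<le> d\<close>, the plan
    \<open>C\<close> reads only earlier robber positions.\<close>
  define W where "W = (\<lambda>\<rho> n. if n < d then w0 n else \<rho> (n - d))"
  define C where "C = (\<lambda>\<rho> t i. if i \<le> L then if t < i then y i t else W \<rho> (t - i) else p i)"
  have W_move: "move G (W \<rho> n) (W \<rho> (Suc n))"
    if "\<rho> 0 = r" "\<And>s. s < t \<Longrightarrow> move G (\<rho> s) (\<rho> (Suc s))" "n < t + d" for \<rho> :: "nat \<Rightarrow> 'a" and n t
  proof -
    consider "Suc n < d" | "Suc n = d" | "d \<le> n" by linarith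
    then show ?thesis
    proof cases
      case 1
      then show ?thesis using w0(3)[of n] by (simp add: W_def)
    next
      case 2
      then show ?thesis using w0(3)[of n] w0(2) that(1) by (simp add: W_def)
    next
      case 3
      then have "n - d < t" "Suc n - d = Suc (n - d)" using that(3) by auto
      then show ?thesis using 3 that(2)[of "n - d"] by (simp add: W_def)
    qed
  qed
  obtain \<rho> where \<rho>: "\<rho> 0 = r" "\<And>t. move G (\<rho> t) (\<rho> (Suc t))" "\<And>t. escapes G k (C \<rho> t) (\<rho> t)"
  proof (rule escaping_play[of C r k p])
    fix \<rho> \<rho>' :: "nat \<Rightarrow> 'a" and t
    assume eq: "\<And>s. s < t \<Longrightarrow> \<rho> s = \<rho>' s"
    have "W \<rho> (t - i) = W \<rho>' (t - i)" for i
      unfolding W_def using start(3) eq[of "t - i - d"] by auto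
    then show "C \<rho> t = C \<rho>' t"
      unfolding C_def by (intro ext) simp
  next
    fix \<rho> :: "nat \<Rightarrow> 'a" and t i
    assume \<rho>: "\<rho> 0 = r" "\<And>s. s < t \<Longrightarrow> move G (\<rho> s) (\<rho> (Suc s))" and i: "i < k"
    have W0: "W \<rho> 0 = p 0"
      using start(3) w0(1) by (simp add: W_def)
    consider "L < i" | "i \<le> L" "Suc t < i" | "i \<le> L" "Suc t = i" | "i \<le> L" "i \<le> t" by linarith
    then show "move G (C \<rho> t i) (C \<rho> (Suc t) i)"
    proof cases
      case 1
      then show ?thesis
        using start(1) i by (simp add: C_def escapes_def move_refl)
    next
      case 2
      then show ?thesis using y(3)[of i t] by (simp add: C_def)
    next
      case 3
      then show ?thesis using y(3)[of i t] y(2)[of i] W0 by (simp add: C_def)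
    next
      case 4
      then have "move G (W \<rho> (t - i)) (W \<rho> (Suc (t - i)))"
        by (intro W_move[of \<rho> t] \<rho>) (use start(3) in auto)
      then show ?thesis using 4 by (simp add: C_def Suc_diff_le)
    qed
  next
    fix \<rho> :: "nat \<Rightarrow> 'a"
    show "C \<rho> 0 = p"
    proof
      show "C \<rho> 0 i = p i" for i
        using start(3) w0(1) y(1)[of i] by (cases "i = 0") (simp_all add: C_def W_def)
    qed
  qed (use start(1) in blast)+
  let ?w = "W \<rho>" and ?c = "C \<rho>"
  have step: "move G (?w n) (?w (Suc n))" for n
    using W_move[of \<rho> "Suc n" n, OF \<rho>(1) \<rho>(2)] by simp
  note walk = relpowp_walk[of "move G" ?w, OF step]
  have backwards: "(move G ^^ m) (?w (n + m)) (?w n)" for n m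
    by (rule reach_sym[OF walk])
  have w_V: "?w n \<in> verts G" for n
    using move_in_verts(1)[OF step] .
  have robber: "?w (t + d) = \<rho> t" for t
    by (simp add: W_def)
  have c_train: "?c t i = ?w (t - i)" if "i \<le> L" "i \<le> t" for t i
    using that by (simp add: C_def)
  \<comment> \<open>Any cop of the train can take over as its head: the order of the cops in front of it is
    reversed, and the cops behind it keep their place.\<close>
  have far: "min m d \<le> e" if "L \<le> n" "m \<le> d + L" "(move G ^^ e) (?w n) (?w (n + m))" for n m e
  proof (cases "m \<le> d")
    case True
    let ?q = "?c n" and ?s = "\<rho> n"
    \<comment> \<open>The supposed short walk is completed along the trail to the robber, who is
      \<open>d\<close> steps ahead of \<open>w n\<close>.\<close>
    have "(move G ^^ (e + (d - m))) (?q 0) ?s"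
      using relpowp_trans[OF that(3) walk[of "d - m" "n + m"]] True c_train[of 0 n] robber[of n]
      by simp
    moreover have "(move G ^^ i) (?q i) (?q 0)" if "i \<le> L" for i
      using walk[of i "n - i"] c_train[of i n] c_train[of 0 n] that \<open>L \<le> n\<close> by simp
    ultimately have "d \<le> e + (d - m)"
      using min[OF \<rho>(3)[of n]] by blast
    then show ?thesis using True by simp
  next
    case False
    define j t where "j = m - d" and "t = n + j"
    define \<pi> where "\<pi> = (\<lambda>i. if i \<le> j then j - i else i)"
    let ?q = "\<lambda>i. ?c t (\<pi> i)"
    have j: "j \<le> L" "n + m = t + d" "t - j = n" "L \<le> t"
      using that False by (auto simp: j_def t_def)
    have q0: "?q 0 = ?w n"
      using c_train[of j t] j by (simp add: \<pi>_def t_def)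
    have "escapes G k ?q (\<rho> t)"
      by (rule escapes_permute[OF \<rho>(3)]) (use j start(2) in \<open>auto simp: \<pi>_def\<close>)
    moreover have "(move G ^^ i) (?q i) (?q 0)" if "i \<le> L" for i
    proof (cases "i \<le> j")
      case True
      then have "?q i = ?w (n + i)"
        using c_train[of "j - i" t] j by (simp add: \<pi>_def t_def)
      then show ?thesis using q0 backwards by simp
    next
      case False
      then have "?q i = ?w (t - i)"
        using c_train[of i t] that j by (simp add: \<pi>_def)
      moreover have "t - i + (i - j) = n"
        using False that j by (simp add: t_def)
      ultimately have "(move G ^^ (i - j)) (?q i) (?q 0)"
        using walk[of "i - j" "t - i"] q0 by simp
      then show ?thesis
        by (rule reach_mono) (use q0 w_V in simp_all)
    qed
    moreover have "(move G ^^ e) (?q 0) (\<rho> t)"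
      using that(3) robber[of t] q0 j by simp
    ultimately have "d \<le> e"
      using min by blast
    then show ?thesis by simp
  qed
  show ?thesis
  \<comment> \<open>After a shift by \<open>L\<close>, every cop of the train has reached the
    trail.\<close>
  proof (rule that[of "\<lambda>n. ?w (n + L)" "\<lambda>t. ?c (t + L)"])
    show "move G (?w (n + L)) (?w (Suc n + L))" for n
      using step by simp
    show "escapes G k (?c (t + L)) (?w (t + d + L))" for t
      using \<rho>(3)[of "t + L"] robber[of "t + L"] by (simp add: ac_simps)
    show "?c (t + L) i = ?w (t - i + L)" if "i \<le> L" "i \<le> t" for t i
      using c_train[of i "t + L"] that by simp
    show "?c (t + L) i = p i" if "L < i" for t i
      using that by (simp add: C_def)
    show "min m d \<le> e" if "m \<le> d + L" "(move G ^^ e) (?w (n + L)) (?w (n + m + L))" for n m e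
    proof (rule far[of "n + L" m e])
      show "(move G ^^ e) (?w (n + L)) (?w (n + L + m))"
        using that(2) by (simp only: add.assoc add.commute[of m L])
    qed (use that in simp_all)
  qed
qed

section \<open>Graphs of maximum degree two\<close>

lemma (in graph) escapes_dist_ge_2:
  assumes "escapes G k p r" "i < k" "(move G ^^ d) (p i) r"
  shows "2 \<le> d"
proof (rule ccontr)
  assume "\<not> 2 \<le> d"
  then have "d = 0 \<or> d = 1" by linarith
  then have "move G (p i) r"
    using assms by (auto simp: escapes_def intro: move_refl)
  then show False using escapes_not_move[OF assms(1,2)] by blast
qed

text \<open>
  Such a graph is a path or a cycle: one cop drives the robber along it and another one just waits.
\<close>

lemma (in graph) not_escapes_if_degree_le_2:
  assumes conn: "connected G" and "2 \<le> k"
    and deg: "\<And>v. v \<in> verts G \<Longrightarrow> \<exists>x y. \<forall>u. v \<rightarrow>\<^bsub>G\<^esub> u \<longrightarrow> u = x \<or> u = y"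
  shows "\<not> escapes G k p r"
proof
  assume pr: "escapes G k p r"
  let ?P = "\<lambda>d. \<exists>q s. escapes G k q s \<and> (move G ^^ d) (q 0) s"
  have "\<exists>d. ?P d"
    using connected_reach[OF conn, of "p 0" r] pr \<open>2 \<le> k\<close> by (auto simp: escapes_def)
  then obtain d where d: "?P d" and d_min: "\<And>e. ?P e \<Longrightarrow> d \<le> e"
    using LeastI_ex[of ?P] Least_le[of ?P] by blast
  then obtain q s where qs: "escapes G k q s" "(move G ^^ d) (q 0) s"
    by blast
  then have d2: "2 \<le> d"
    using escapes_dist_ge_2[of k q s 0 d] \<open>2 \<le> k\<close> by simp
  obtain w c where w: "\<And>n. move G (w n) (w (Suc n))"
    and c: "\<And>t. escapes G k (c t) (w (t + d))" "\<And>t i. 0 < i \<Longrightarrow> c t i = q i"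
    and far: "\<And>n m e. m \<le> d + 0 \<Longrightarrow> (move G ^^ e) (w n) (w (n + m)) \<Longrightarrow> min m d \<le> e"
  proof (rule no_shortcut_walk[of k q s 0 d])
    show "d \<le> e" if "escapes G k q' s'" "(move G ^^ e) (q' 0) s'" for q' s' e
      using d_min that by blast
  qed (use qs d2 \<open>2 \<le> k\<close> in auto)
  \<comment> \<open>As \<open>2 \<le> d\<close>, the trail neither pauses nor turns back, so its two
    neighbours at a vertex are distinct and exhaust the degree.\<close>
  have ne: "w n \<noteq> w (n + m)" if "1 \<le> m" "m \<le> 2" for n m
    using far[of m 0 n] that d2 by auto
  have adj: "w n \<rightarrow>\<^bsub>G\<^esub> w (Suc n)" for n
    using w[of n] ne[of 1 n] by (auto simp: move_def)
  have w_V: "w n \<in> verts G" for n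
    using move_in_verts(1)[OF w] .
  have "u = w n \<or> u = w (Suc (Suc n))" if "w (Suc n) \<rightarrow>\<^bsub>G\<^esub> u" for n u
  proof -
    obtain x y where xy: "\<And>u. w (Suc n) \<rightarrow>\<^bsub>G\<^esub> u \<Longrightarrow> u = x \<or> u = y"
      using deg[OF w_V[of "Suc n"]] by blast
    show ?thesis
      using xy[OF that] xy[OF arc_sym[OF adj[of n]]] xy[OF adj[of "Suc n"]] ne[of 2 n] by auto
  qed
  moreover have q1: "q 1 \<in> verts G"
    using qs(1) \<open>2 \<le> k\<close> by (simp add: escapes_def)
  \<comment> \<open>The trail meets the waiting cop 1; \<open>d \<le> n\<close> ensures that this
    point of the trail is a robber position, at time \<open>n - d\<close>.\<close>
  ultimately obtain n where n: "d \<le> n" "w n = q 1"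
    using walk_covers[where w = w and N = 0 and M = d, OF conn w_V] by blast
  then have "c (n - d) 1 = w (n - d + d)"
    using c(2)[of 1] by simp
  then have "move G (c (n - d) 1) (w (n - d + d))"
    using move_refl[OF q1] n by simp
  then show False
    using escapes_not_move[OF c(1)] \<open>2 \<le> k\<close> by simp
qed

section \<open>Forbidden subgraphs at a fork of the trail\<close>

text \<open>\<open>M\<close> bounds the neighbours of \<open>u\<close> within the stretch
  considered. From the last one, \<open>v m\<close>, the trail still runs \<open>l\<close> steps
  inside the controlled range \<open>M + l\<close>, and \<open>v (m - 1)\<close> is available since
  \<open>1 \<le> m\<close>.\<close>

lemma (in graph) contains_claw_or_paw_if_fork:
  assumes "1 \<le> l"
    and w: "\<And>n. move G (v n) (v (Suc n))"
    and far: "\<And>i j. \<lbrakk>i + 2 \<le> j; j \<le> i + l + 1; j \<le> M + l\<rbrakk> \<Longrightarrow> \<not> move G (v i) (v j)"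
    and u: "v 1 \<rightarrow>\<^bsub>G\<^esub> u" "\<And>j. j \<le> M + l \<Longrightarrow> u \<noteq> v j"
    and u_far: "\<And>j. \<lbrakk>M < j; j \<le> M + l\<rbrakk> \<Longrightarrow> \<not> u \<rightarrow>\<^bsub>G\<^esub> v j"
    and M: "1 \<le> M"
  shows "contains_induced G (with_proj (H1 l)) \<or> contains_induced G (with_proj (H2 l))"
proof -
  let ?A = "{b. b \<le> M \<and> u \<rightarrow>\<^bsub>G\<^esub> v b}"
  define m where "m = Max ?A"
  have fin: "finite ?A" by simp
  have one: "1 \<in> ?A"
    using M arc_sym[OF u(1)] by simp
  have "m \<in> ?A"
    unfolding m_def using Max_in[OF fin] one by blast
  moreover have "1 \<le> m"
    unfolding m_def using Max_ge[OF fin one] .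
  ultimately have m: "1 \<le> m" "m \<le> M" "u \<rightarrow>\<^bsub>G\<^esub> v m" by auto
  have last: "\<not> u \<rightarrow>\<^bsub>G\<^esub> v j" if "m < j" "j \<le> M + l" for j
  proof (cases "j \<le> M")
    case True
    show ?thesis
    proof
      assume "u \<rightarrow>\<^bsub>G\<^esub> v j"
      then have "j \<le> m"
        unfolding m_def using True by (intro Max_ge[OF fin]) simp
      then show False using that by simp
    qed
  qed (use u_far that in simp)
  \<comment> \<open>A pause would let one move cover two trail steps. As \<open>1 \<le> l\<close>,
    \<open>far\<close> forbids this.\<close>
  have ne: "v n \<noteq> v (Suc n)" if "Suc n \<le> M + l" for n
  proof
    assume eq: "v n = v (Suc n)"
    show False
    proof (cases n)
      case 0
      then show ?thesis
        using far[of 0 2] w[of 1] eq assms(1) M by (simp add: numeral_2_eq_2)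
    next
      case (Suc n')
      then show ?thesis
        using far[of n' "Suc n"] w[of n'] eq assms(1) that by simp
    qed
  qed
  have adj: "v n \<rightarrow>\<^bsub>G\<^esub> v (Suc n)" if "Suc n \<le> M + l" for n
    using w[of n] ne[OF that] by (auto simp: move_def)
  show ?thesis
  proof (rule contains_claw_or_paw[where v = "\<lambda>i. v (m - 1 + i)" and u = u])
    show "v (m - 1 + i) \<rightarrow>\<^bsub>G\<^esub> v (m - 1 + Suc i)" if "i \<le> l" for i
      using adj[of "m - 1 + i"] that m by simp
    show "v (m - 1 + i) \<noteq> v (m - 1 + j) \<and> \<not> v (m - 1 + i) \<rightarrow>\<^bsub>G\<^esub> v (m - 1 + j)"
      if "i + 2 \<le> j" "j \<le> Suc l" for i j
    proof -
      have "\<not> move G (v (m - 1 + i)) (v (m - 1 + j))"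
        by (rule far) (use that m in linarith)+
      then show ?thesis
        using move_in_verts(1)[OF w] by (metis move_def)
    qed
    show "u \<rightarrow>\<^bsub>G\<^esub> v (m - 1 + 1)"
      using m by simp
    show "u \<noteq> v (m - 1 + 0)"
      using u(2) m by simp
    show "u \<noteq> v (m - 1 + j) \<and> \<not> u \<rightarrow>\<^bsub>G\<^esub> v (m - 1 + j)" if "2 \<le> j" "j \<le> Suc l" for j
      using u(2)[of "m - 1 + j"] last[of "m - 1 + j"] that m by simp
  qed
qed

text \<open>
  If the head of the train is adjacent to the robber after every move of the cops, a third
  neighbour \<^term>\<open>u\<close> of a vertex of the trail is guarded by the last cop of the train.
\<close>

lemma (in graph) contains_claw_or_paw_if_guard:
  assumes "1 \<le> l"
    and w: "\<And>n. move G (w n) (w (Suc n))"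
    and q: "escapes G (l + 1) q (w (l + 3))" "\<And>i. i \<le> l \<Longrightarrow> q i = w (l + 1 - i)"
    and far: "\<And>i j. \<lbrakk>i + 2 \<le> j; j \<le> i + l + 2; j \<le> l + 3\<rbrakk> \<Longrightarrow> \<not> move G (w i) (w j)"
    and u: "w 1 \<rightarrow>\<^bsub>G\<^esub> u" "u \<noteq> w 0" "u \<noteq> w 2"
  shows "contains_induced G (with_proj (H1 l)) \<or> contains_induced G (with_proj (H2 l))"
proof -
  define V where "V = (\<lambda>\<rho> n. if n < l + 3 then w n else \<rho> (n - (l + 3)))"
  \<comment> \<open>Cop \<open>l\<close> starts on \<open>w 1\<close>, moves to \<open>u\<close> and
    stays there; the remaining \<open>l\<close> cops keep following the trail, the head two steps
    behind the robber.\<close>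
  define C where "C = (\<lambda>\<rho> t i. if t = 0 \<or> l < i then q i
    else if i < l then V \<rho> (l + 1 + t - i) else u)"
  have V_move: "move G (V \<rho> n) (V \<rho> (Suc n))"
    if "\<rho> 0 = w (l + 3)" "\<And>s. s < t \<Longrightarrow> move G (\<rho> s) (\<rho> (Suc s))" "n < t + (l + 3)"
    for \<rho> :: "nat \<Rightarrow> 'a" and n t
  proof -
    consider "Suc n < l + 3" | "Suc n = l + 3" | "l + 3 \<le> n" by linarith
    then show ?thesis
    proof cases
      case 1
      then show ?thesis using w[of n] by (simp add: V_def)
    next
      case 2
      have "V \<rho> n = w n" using 2 by (simp add: V_def)
      moreover have "V \<rho> (Suc n) = w (Suc n)" unfolding 2 by (simp add: V_def that(1))
      ultimately show ?thesis using w[of n] by simp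
    next
      case 3
      then have "n - (l + 3) < t" "Suc n - (l + 3) = Suc (n - (l + 3))" using that(3) by auto
      then show ?thesis using 3 that(2)[of "n - (l + 3)"] by (simp add: V_def)
    qed
  qed
  have u_V: "u \<in> verts G"
    using u(1) adj_in_verts(2) by blast
  obtain \<rho> where \<rho>: "\<rho> 0 = w (l + 3)" "\<And>t. move G (\<rho> t) (\<rho> (Suc t))"
    "\<And>t. escapes G (l + 1) (C \<rho> t) (\<rho> t)"
  proof (rule escaping_play[of C "w (l + 3)" "l + 1" q])
    fix \<rho> \<rho>' :: "nat \<Rightarrow> 'a" and t
    assume eq: "\<And>s. s < t \<Longrightarrow> \<rho> s = \<rho>' s"
    have "V \<rho> (l + 1 + t - i) = V \<rho>' (l + 1 + t - i)" for i
      unfolding V_def using eq[of "l + 1 + t - i - (l + 3)"] by auto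
    then show "C \<rho> t = C \<rho>' t"
      unfolding C_def by (intro ext) simp
  next
    fix \<rho> :: "nat \<Rightarrow> 'a" and t i
    assume \<rho>: "\<rho> 0 = w (l + 3)" "\<And>s. s < t \<Longrightarrow> move G (\<rho> s) (\<rho> (Suc s))" and i: "i < l + 1"
    show "move G (C \<rho> t i) (C \<rho> (Suc t) i)"
    proof (cases "i < l")
      case True
      moreover have "l + 1 - i < l + 3" by linarith
      ultimately have "C \<rho> t i = V \<rho> (l + 1 + t - i)"
        using q(2)[of i] by (simp add: C_def V_def)
      moreover have "C \<rho> (Suc t) i = V \<rho> (Suc (l + 1 + t - i))"
        using True by (simp add: C_def Suc_diff_le)
      ultimately show ?thesis
        using V_move[of \<rho> t "l + 1 + t - i", OF \<rho>] by simp
    next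
      case False
      then have "i = l" using i by simp
      then show ?thesis
        using q(2)[of l] u(1) u_V by (auto simp: C_def move_def adj_in_verts)
    qed
  next
    show "C \<rho> 0 = q" for \<rho>
      by (simp add: C_def)
  qed (use q(1) in blast)+
  let ?v = "V \<rho>"
  have step: "move G (?v n) (?v (Suc n))" for n
    using V_move[of \<rho> "Suc n" n, OF \<rho>(1) \<rho>(2)] by simp
  have v_w: "?v n = w n" if "n \<le> l + 3" for n
    using that \<rho>(1) by (cases "n = l + 3") (simp_all add: V_def)
  have robber: "?v (l + 3 + t) = \<rho> t" for t
    by (simp add: V_def)
  have v_far: "\<not> move G (?v i) (?v j)" if "i + 2 \<le> j" "j \<le> i + l + 1" for i j
  proof (cases "j \<le> l + 3")
    case True
    then show ?thesis using far[of i j] that v_w by simp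
  next
    case False
    \<comment> \<open>When the robber is at \<open>?v j\<close>, cop \<open>a\<close> stands on
      \<open>?v i\<close> and cannot reach him. Without the guard the train has one cop less, so
      this works up to \<open>i + l + 1\<close> instead of \<open>i + l + 2\<close>.\<close>
    define t a where "t = j - (l + 3)" and "a = j - 2 - i"
    have a: "a < l" "0 < t" "j = l + 3 + t" "l + 1 + t - a = i"
      using False that by (auto simp: t_def a_def)
    then have "C \<rho> t a = ?v i"
      by (simp add: C_def)
    then show ?thesis
      using escapes_not_move[OF \<rho>(3)[of t], of a] a robber[of t] by simp
  qed
  \<comment> \<open>The guard is on \<open>u\<close> only after its first move, so trail neighbours
    of \<open>u\<close> are excluded only beyond \<open>l + 3\<close>, which serves as
    \<open>M\<close>.\<close>
  have u_far: "\<not> move G u (?v j)" if "l + 3 < j" for j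
  proof -
    define t where "t = j - (l + 3)"
    have t: "0 < t" "j = l + 3 + t"
      using that by (auto simp: t_def)
    then show ?thesis
      using escapes_not_move[OF \<rho>(3)[of t], of l] robber[of t] by (simp add: C_def)
  qed
  have u_ne: "u \<noteq> ?v j" for j
  proof -
    consider "j = 0" | "j = 1" | "j = 2" | "3 \<le> j" "j \<le> l + 3" | "l + 3 < j" by linarith
    then show ?thesis
    proof cases
      case 2
      then show ?thesis using u(1) v_w[of 1] adj_not_same by auto
    next
      case 4
      then have "\<not> move G (w 1) (w j)" by (intro far) auto
      then show ?thesis using u(1) v_w[of j] 4 by (auto simp: move_def adj_in_verts)
    next
      case 5
      then show ?thesis using u_far[of j] u_V move_refl by metis
    qed (use u v_w[of j] in auto)
  qed
  show ?thesis
  proof (rule contains_claw_or_paw_if_fork[where v = ?v and u = u and M = "l + 3"])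
    show "?v 1 \<rightarrow>\<^bsub>G\<^esub> u"
      using u(1) v_w[of 1] by simp
    show "\<not> u \<rightarrow>\<^bsub>G\<^esub> ?v j" if "l + 3 < j" for j
      using u_far[OF that] u_V by (simp add: move_def)
  qed (use assms(1) step v_far u_ne in auto)
qed

section \<open>A minimal train and the final contradiction\<close>

lemma (in graph) cops_win_if_no_claw_or_paw:
  assumes "1 \<le> l" and conn: "connected G"
    and free: "\<not> contains_induced G (with_proj (H1 l))" "\<not> contains_induced G (with_proj (H2 l))"
  shows "cops_win G (l + 1)"
proof (rule ccontr)
  assume lose: "\<not> cops_win G (l + 1)"
  obtain v0 where v0: "v0 \<in> verts G"
    using conn by (auto simp: connected_conv)
  then obtain r0 where r0: "escapes G (l + 1) (\<lambda>_. v0) r0"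
    using cops_winI[of "l + 1" "\<lambda>_. v0"] lose by (auto simp: escapes_def)
  let ?P = "\<lambda>d. \<exists>q s. escapes G (l + 1) q s \<and> (\<forall>i\<le>l. (move G ^^ i) (q i) (q 0)) \<and>
    (move G ^^ d) (q 0) s"
  \<comment> \<open>With all cops on \<open>v0\<close> the closeness condition holds, so positions
    as in \<open>?P\<close> exist.\<close>
  have "(move G ^^ i) v0 v0" for i
    using reach_mono[of 0 G v0 v0 i] v0 by simp
  then have "\<exists>d. ?P d"
    using connected_reach[OF conn v0, of r0] r0 by (force simp: escapes_def)
  then obtain d where d: "?P d" and d_min: "\<And>e. ?P e \<Longrightarrow> d \<le> e"
    using LeastI_ex[of ?P] Least_le[of ?P] by blast
  then obtain p r where pr: "escapes G (l + 1) p r" "\<And>i. i \<le> l \<Longrightarrow> (move G ^^ i) (p i) (p 0)"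
    "(move G ^^ d) (p 0) r"
    by blast
  have d2: "2 \<le> d"
    using escapes_dist_ge_2[OF pr(1) _ pr(3)] by simp
  obtain w c where w: "\<And>n. move G (w n) (w (Suc n))"
    and c: "\<And>t. escapes G (l + 1) (c t) (w (t + d))"
      "\<And>t i. i \<le> l \<Longrightarrow> i \<le> t \<Longrightarrow> c t i = w (t - i)"
    and far: "\<And>n m e. m \<le> d + l \<Longrightarrow> (move G ^^ e) (w n) (w (n + m)) \<Longrightarrow> min m d \<le> e"
  proof (rule no_shortcut_walk[of "l + 1" p r l d])
    show "d \<le> e" if "escapes G (l + 1) q s" "\<And>i. i \<le> l \<Longrightarrow> (move G ^^ i) (q i) (q 0)"
      "(move G ^^ e) (q 0) s" for q s e
      using d_min that by blast
  qed (use pr d2 in auto)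
  have w_V: "w n \<in> verts G" for n
    using move_in_verts(1)[OF w] .
  have ne: "w n \<noteq> w (n + m)" if "1 \<le> m" "m \<le> d + l" for n m
    using far[of m 0 n] that d2 by auto
  have not_move: "\<not> move G (w n) (w (n + m))" if "2 \<le> m" "m \<le> d + l" for n m
    using far[of m 1 n] that d2 by (auto simp: eq_OO)
  have two: "u = w n \<or> u = w (Suc (Suc n))" if arc: "w (Suc n) \<rightarrow>\<^bsub>G\<^esub> u" for n u
  proof (rule ccontr)
    assume "\<not> ?thesis"
    then have u: "u \<noteq> w n" "u \<noteq> w (Suc (Suc n))" by auto
    let ?v = "\<lambda>i. w (n + i)"
    have v_far: "\<not> move G (?v i) (?v j)" if "i + 2 \<le> j" "j \<le> i + l + 2" for i j
      using not_move[of "j - i" "n + i"] that d2 by simp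
    have "contains_induced G (with_proj (H1 l)) \<or> contains_induced G (with_proj (H2 l))"
    proof (cases "d = 2")
      case True
      show ?thesis
      \<comment> \<open>At time \<open>n + l + 1\<close> the last cop stands on
        \<open>w (Suc n)\<close>, next to \<open>u\<close>.\<close>
      proof (rule contains_claw_or_paw_if_guard[where w = ?v and u = u and q = "c (n + l + 1)"])
        show "escapes G (l + 1) (c (n + l + 1)) (?v (l + 3))"
          using c(1)[of "n + l + 1"] True by (simp add: ac_simps numeral_3_eq_3)
        show "c (n + l + 1) i = ?v (l + 1 - i)" if "i \<le> l" for i
          using c(2)[of i "n + l + 1"] that by simp
      qed (use assms(1) w v_far arc u in auto)
    next
      case False
      have u_V: "u \<in> verts G" using arc adj_in_verts(2) by blast
      \<comment> \<open>Through \<open>u\<close>, two moves would lead from \<open>w (Suc n)\<close>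
        to a vertex at least three steps further along the trail, a shortcut when
        \<open>3 \<le> d\<close>. Hence \<open>M = 3\<close> below.\<close>
      have u_far: "\<not> move G u (?v j)" if "4 \<le> j" "j \<le> l + 3" for j
      proof
        assume "move G u (?v j)"
        moreover have "move G (w (Suc n)) u"
          using arc w_V by (simp add: move_def)
        ultimately have "(move G ^^ 2) (w (Suc n)) (w (Suc n + (j - 1)))"
          using that by (auto simp: numeral_2_eq_2)
        then have "min (j - 1) d \<le> 2"
          by (rule far[rotated]) (use False d2 that in linarith)
        then show False using that False d2 by simp
      qed
      have u_ne: "u \<noteq> ?v j" if "j \<le> l + 3" for j
      proof -
        consider "j = 0" | "j = 1" | "j = 2" | "3 \<le> j" by linarith
        then show ?thesis
        proof cases
          case 2
          then show ?thesis using arc adj_not_same by auto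
        next
          case 4
          then have "\<not> move G (?v 1) (?v j)" using that by (intro v_far) auto
          then show ?thesis using arc w_V by (auto simp: move_def)
        qed (use u in auto)
      qed
      show ?thesis
      proof (rule contains_claw_or_paw_if_fork[where v = ?v and u = u and M = 3])
        show "\<not> u \<rightarrow>\<^bsub>G\<^esub> ?v j" if "3 < j" "j \<le> 3 + l" for j
          using u_far[of j] u_V that by (simp add: move_def)
      qed (use assms(1) w v_far arc u_ne in auto)
    qed
    then show False using free by blast
  qed
  \<comment> \<open>A visit at a positive index is required so that \<open>v\<close> also has a
    predecessor on the trail, as in \<open>two\<close>.\<close>
  have "\<exists>x y. \<forall>u. v \<rightarrow>\<^bsub>G\<^esub> u \<longrightarrow> u = x \<or> u = y" if "v \<in> verts G" for v
  proof -
    obtain n where "1 \<le> n" "w n = v"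
      using walk_covers[where w = w and N = 0 and M = 1, OF conn w_V two \<open>v \<in> verts G\<close>]
      by blast
    then show ?thesis
      using two[of "n - 1"] by auto
  qed
  then show False
    using not_escapes_if_degree_le_2[OF conn, of "l + 1"] pr(1) assms(1) by auto
qed

theorem theorem2:
  fixes l :: nat and G :: "('a, 'b) pre_digraph"
  assumes "l \<ge> 1"
    and "graph G"
    and "Digraph_Component.connected G"
    and "\<not> contains_induced G (with_proj (H1 l))"
    and "\<not> contains_induced G (with_proj (H2 l))"
  shows "cop_number G \<le> l + 1"
proof -
  interpret graph G by fact
  have "cops_win G (l + 1)"
    by (rule cops_win_if_no_claw_or_paw) (use assms in auto)
  then show ?thesis
    unfolding cop_number_def by (rule Least_le)
qed

end
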